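(* Let $\tau$ be a substitution on $\mathcal A=\{0,1,\ldots,n-1\}$ satisfying the standing assumptions below, which is prefix permutative and suffix permutative and has $n$ right-infinite fixed points, the $i$-th of which is a $k_i$-branch point. Suppose $\mathcal L_\tau$ has exactly $N$ words of length $2$. Then there exists a substitution $\tau'$ on $\mathcal A'=\{0,1,\ldots,N-1\}$ such that $\tau'$ is suffix permutative, has $n$ fixed points, the $i$-th of which is a $k_i$-branch point, $(X_\tau,\sigma)$ is topologically conjugate to $(X_{\tau'},\sigma)$, and the Vershik map $V_{\tau'}$ on $\mathcal B_{\tau'}$ extends continuously so that $(X_{\tau'},\sigma)$ is topologically conjugate to $(X_{\mathcal B_{\tau'}},V_{\tau'})$.
   Context: Substitutions are extended to words and one-sided sequences by concatenation; $\sigma$ is the left shift; for a substitution $\theta$, $X_\theta\subset\mathcal A^{\mathbb N}$ is the closure of the shift orbit of a (generating) fixed point, $\mathcal L_\theta$ the set of subwords of the words $\theta^m(a)$. $\tau$ is prefix (suffix) permutative if the map sending each letter $a$ to the first (last) letter of $\tau(a)$ is a permutation of $\mathcal A$. A $k$-branch point of $X_\theta$ is a point with exactly $k$ preimages under $\sigma:X_\theta\to X_\theta$, $k\ge2$. Standing assumptions: $\tau$ primitive, $X_\tau$ infinite, $\tau$ unilaterally recognizable, all powers injective on letters. $\mathcal B_{\tau'}$ is the stationary ordered Bratteli diagram of $\tau'$: $V_0=\{v_0\}$, $V_n=\mathcal A'$ for $n\ge1$, one edge from $v_0$ to each vertex of $V_1$, and for $n\ge2$ the edges into $a\in V_n$,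 in increasing order, have as sources in $V_{n-1}$ the successive letters of $\tau'(a)$. $X_{\mathcal B_{\tau'}}$ is the space of infinite paths (product topology). For non-maximal $x$, with $k$ least such that $x_k$ is not maximal and $y_k$ its successor, $V_{\tau'}(x)=(z_1,\ldots,z_{k-1},y_k,x_{k+1},\ldots)$, $z_1\cdots z_{k-1}$ the minimal path from $v_0$ to $s(y_k)$. *)

theory Defs
  imports "HOL-Analysis.Analysis"
begin

text \<open>Letters are natural numbers; a substitution on the alphabet {0,...,n-1} is a
function tau :: nat => nat list with tau a a word over {0,...,n-1} for a < n.
One-sided sequences are functions nat => nat, with the product topology
(nat carries the discrete topology).\<close>

definition is_subst :: "nat \<Rightarrow> (nat \<Rightarrow> nat list) \<Rightarrow> bool" where
  "is_subst n \<theta> \<longleftrightarrow> (\<forall>a<n. set (\<theta> a) \<subseteq> {..<n})"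

definition subst_word :: "(nat \<Rightarrow> nat list) \<Rightarrow> nat list \<Rightarrow> nat list" where
  "subst_word \<theta> w = concat (map \<theta> w)"

text \<open>Extension to one-sided sequences by concatenation (meaningful for non-erasing
substitutions): the j-th letter of theta(x) is the j-th letter of theta(x_0...x_j).\<close>
definition subst_seq :: "(nat \<Rightarrow> nat list) \<Rightarrow> (nat \<Rightarrow> nat) \<Rightarrow> (nat \<Rightarrow> nat)" where
  "subst_seq \<theta> x = (\<lambda>j. concat (map \<theta> (map x [0..<Suc j])) ! j)"

definition shift :: "(nat \<Rightarrow> 'b) \<Rightarrow> (nat \<Rightarrow> 'b)" where
  "shift x = (\<lambda>i. x (Suc i))"

definition subst_pow :: "(nat \<Rightarrow> nat list) \<Rightarrow> nat \<Rightarrow> nat \<Rightarrow> nat list" where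
  "subst_pow \<theta> m a = (subst_word \<theta> ^^ m) [a]"

definition lang :: "nat \<Rightarrow> (nat \<Rightarrow> nat list) \<Rightarrow> nat list set" where
  "lang n \<theta> = {w. \<exists>a<n. \<exists>m. \<exists>u v. subst_pow \<theta> m a = u @ w @ v}"

definition gen_fixed :: "nat \<Rightarrow> (nat \<Rightarrow> nat list) \<Rightarrow> (nat \<Rightarrow> nat) \<Rightarrow> bool" where
  "gen_fixed n \<theta> u \<longleftrightarrow> u 0 < n \<and> \<theta> (u 0) \<noteq> [] \<and> hd (\<theta> (u 0)) = u 0
     \<and> (\<forall>L. \<exists>m. L < length (subst_pow \<theta> m (u 0)))
     \<and> (\<forall>m i. i < length (subst_pow \<theta> m (u 0)) \<longrightarrow> u i = subst_pow \<theta> m (u 0) ! i)"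

text \<open>X_theta: closure of the shift orbit of a generating fixed point (taken over all
generating fixed points, which for primitive theta all give the same set).\<close>
definition Xsub :: "nat \<Rightarrow> (nat \<Rightarrow> nat list) \<Rightarrow> (nat \<Rightarrow> nat) set" where
  "Xsub n \<theta> = closure {(shift ^^ m) u | m u. gen_fixed n \<theta> u}"

definition primitive :: "nat \<Rightarrow> (nat \<Rightarrow> nat list) \<Rightarrow> bool" where
  "primitive n \<theta> \<longleftrightarrow> (\<exists>m\<ge>1. \<forall>a<n. \<forall>b<n. b \<in> set (subst_pow \<theta> m a))"

definition unilat_recognizable :: "nat \<Rightarrow> (nat \<Rightarrow> nat list) \<Rightarrow> bool" where
  "unilat_recognizable n \<theta> \<longleftrightarrow>
     (\<forall>x\<in>Xsub n \<theta>. \<exists>!(k, y). y \<in> Xsub n \<theta> \<and> k < length (\<theta> (y 0))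
                         \<and> x = (shift ^^ k) (subst_seq \<theta> y))"

definition powers_inj :: "nat \<Rightarrow> (nat \<Rightarrow> nat list) \<Rightarrow> bool" where
  "powers_inj n \<theta> \<longleftrightarrow> (\<forall>m. inj_on (subst_pow \<theta> m) {..<n})"

definition standing :: "nat \<Rightarrow> (nat \<Rightarrow> nat list) \<Rightarrow> bool" where
  "standing n \<theta> \<longleftrightarrow> is_subst n \<theta> \<and> primitive n \<theta> \<and> infinite (Xsub n \<theta>)
     \<and> unilat_recognizable n \<theta> \<and> powers_inj n \<theta>"

definition prefix_perm :: "nat \<Rightarrow> (nat \<Rightarrow> nat list) \<Rightarrow> bool" where
  "prefix_perm n \<theta> \<longleftrightarrow> (\<forall>a<n. \<theta> a \<noteq> []) \<and> bij_betw (\<lambda>a. hd (\<theta> a)) {..<n} {..<n}"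

definition suffix_perm :: "nat \<Rightarrow> (nat \<Rightarrow> nat list) \<Rightarrow> bool" where
  "suffix_perm n \<theta> \<longleftrightarrow> (\<forall>a<n. \<theta> a \<noteq> []) \<and> bij_betw (\<lambda>a. last (\<theta> a)) {..<n} {..<n}"

definition fixpts :: "nat \<Rightarrow> (nat \<Rightarrow> nat list) \<Rightarrow> (nat \<Rightarrow> nat) set" where
  "fixpts n \<theta> = {x. (\<forall>i. x i < n) \<and> subst_seq \<theta> x = x}"

definition branch_point :: "(nat \<Rightarrow> nat) set \<Rightarrow> (nat \<Rightarrow> nat) \<Rightarrow> nat \<Rightarrow> bool" where
  "branch_point X x k \<longleftrightarrow> x \<in> X \<and> 2 \<le> k \<and> finite {y\<in>X. shift y = x} \<and> card {y\<in>X. shift y = x} = k"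

definition top_conj :: "(nat \<Rightarrow> nat) set \<Rightarrow> (nat \<Rightarrow> nat) set \<Rightarrow> bool" where
  "top_conj X Y \<longleftrightarrow> (\<exists>h g. homeomorphism X Y h g \<and> (\<forall>x\<in>X. h (shift x) = shift (h x)))"

text \<open>Stationary ordered Bratteli diagram of theta on {0..N-1}.  A path is a function
p :: nat => nat * nat; p i is the edge of level i+1, encoded as (a, j): its range is
vertex a of V_(i+1) and it is the j-th (0-based, in increasing order) edge into a.
For i = 0 the only edge into a is (a, 0) (source v_0); for i >= 1 the edge (a, j)
has j < |theta(a)| and source theta(a)_j in V_i.\<close>
definition bratteli_paths :: "nat \<Rightarrow> (nat \<Rightarrow> nat list) \<Rightarrow> (nat \<Rightarrow> nat \<times> nat) set" where
  "bratteli_paths N \<theta> = {p. (\<forall>i. fst (p i) < N) \<and> snd (p 0) = 0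
      \<and> (\<forall>i. snd (p (Suc i)) < length (\<theta> (fst (p (Suc i))))
             \<and> \<theta> (fst (p (Suc i))) ! snd (p (Suc i)) = fst (p i))}"

definition max_edge :: "(nat \<Rightarrow> nat list) \<Rightarrow> nat \<Rightarrow> nat \<times> nat \<Rightarrow> bool" where
  "max_edge \<theta> i e \<longleftrightarrow> (i = 0 \<or> Suc (snd e) = length (\<theta> (fst e)))"

definition max_path :: "(nat \<Rightarrow> nat list) \<Rightarrow> (nat \<Rightarrow> nat \<times> nat) \<Rightarrow> bool" where
  "max_path \<theta> p \<longleftrightarrow> (\<forall>i. max_edge \<theta> i (p i))"

text \<open>Vershik map on non-maximal paths: k least level with non-maximal edge, replaced by
its successor y_k = (a, j+1), below it the minimal path from v_0 to s(y_k).\<close>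
definition vershik :: "(nat \<Rightarrow> nat list) \<Rightarrow> (nat \<Rightarrow> nat \<times> nat) \<Rightarrow> (nat \<Rightarrow> nat \<times> nat)" where
  "vershik \<theta> p = (let k = (LEAST i. \<not> max_edge \<theta> i (p i));
                      a = fst (p k); j = snd (p k);
                      s = \<theta> a ! Suc j
                   in (\<lambda>i. if k < i then p i
                           else if i = k then (a, Suc j)
                           else (((\<lambda>b. hd (\<theta> b)) ^^ (k - 1 - i)) s, 0)))"

end

(* Idea: code the 2-blocks.  Counting the n fixed points forces hd (tau a) = a and |tau a| >= 2 for
   every letter a.  Let tau' send the letter (ab) to the 2-blocks of the word tau(a) b.  Its last
   letter is (last(tau a), b), so tau' is suffix permutative, and the 2-block map is a
   conjugacy intertwining tau and tau', hence it carries fixed points and branch points along.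
   By recognizability, each point of X_tau has an infinite sequence of desubstitutions, which is a
   path of the diagram of tau'.  A vertex (ab) of the path records one letter beyond a, and
   |tau b| >= 2 makes the known window to the right grow with the level, so the path determines the
   point even when it is eventually maximal; this is what lets the Vershik map extend. *)
theory Submission
  imports Defs
begin

section \<open>Finite agreement and prefixes of sequences\<close>

definition agree :: "nat \<Rightarrow> (nat \<Rightarrow> 'a) \<Rightarrow> (nat \<Rightarrow> 'a) \<Rightarrow> bool" where
  "agree L x y \<longleftrightarrow> (\<forall>i<L. x i = y i)"

definition starts :: "(nat \<Rightarrow> 'a) \<Rightarrow> 'a list \<Rightarrow> bool" where
  "starts x w \<longleftrightarrow> (\<forall>i<length w. x i = w ! i)"

lemma shift_apply [simp]: "shift x i = x (Suc i)"
  by (simp add: shift_def)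

lemma funpow_shift_apply [simp]: "(shift ^^ m) x i = x (m + i)"
  by (induction m arbitrary: i) auto

lemma agree_shift: "agree (Suc L) x y \<Longrightarrow> agree L (shift x) (shift y)"
  by (simp add: agree_def)

lemma starts_Nil [simp]: "starts x []"
  by (simp add: starts_def)

lemma starts_Cons: "starts x (a # w) \<longleftrightarrow> x 0 = a \<and> starts (shift x) w"
  unfolding starts_def by (auto simp: nth_Cons split: nat.splits dest: spec[of _ "Suc _"])

subsection \<open>Topology of sequence spaces\<close>

lemma open_agree: "open {y :: nat \<Rightarrow> 'a::discrete_topology. agree L x y}"
proof -
  have "open ((\<lambda>y :: nat \<Rightarrow> 'a. y i) -` {x i})" for i
    by (rule open_vimage[OF open_discrete continuous_on_product_coordinates])
  moreover have "{y. agree L x y} = (\<Inter>i\<in>{..<L}. (\<lambda>y. y i) -` {x i})"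
    by (auto simp: agree_def)
  ultimately show ?thesis by (auto intro!: open_INT)
qed

text \<open>A coordinate determined near each point by finitely many letters is locally constant,
  hence continuous whatever the topology of the codomain.\<close>

lemma continuous_on_seqI:
  fixes f :: "(nat \<Rightarrow> 'a::discrete_topology) \<Rightarrow> nat \<Rightarrow> 'b::topological_space"
  assumes "\<And>x i. x \<in> S \<Longrightarrow> \<exists>L. \<forall>y\<in>S. agree L x y \<longrightarrow> f y i = f x i"
  shows "continuous_on S f"
proof (rule continuous_on_coordinatewise_then_product)
  fix i
  show "continuous_on S (\<lambda>x. f x i)"
    unfolding continuous_on_def
  proof (intro ballI tendsto_eventually)
    fix x assume "x \<in> S"
    then obtain L where L: "\<forall>y\<in>S. agree L x y \<longrightarrow> f y i = f x i" using assms by blast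
    then show "\<forall>\<^sub>F y in at x within S. f y i = f x i"
      unfolding eventually_at_topological
      by (intro exI[of _ "{y. agree L x y}"]) (auto simp: open_agree, simp add: agree_def)
  qed
qed

text \<open>Continuous maps into a discrete space are locally constant, so \<open>F\<close> may be
  arbitrary; it will be the numbering of 2-blocks.\<close>

lemma continuous_on_discrete_binary:
  fixes f g :: "'c::topological_space \<Rightarrow> 'a::discrete_topology"
  assumes "continuous_on S f" "continuous_on S g"
  shows "continuous_on S (\<lambda>x. F (f x) (g x) :: 'b::topological_space)"
  unfolding continuous_on_def
proof (intro ballI tendsto_eventually)
  fix x assume "x \<in> S"
  then have "\<forall>\<^sub>F y in at x within S. f y = f x" "\<forall>\<^sub>F y in at x within S. g y = g x"
    using assms by (auto simp: continuous_on_def tendsto_discrete)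
  then show "\<forall>\<^sub>F y in at x within S. F (f y) (g y) = F (f x) (g x)"
    by eventually_elim simp
qed

text \<open>A basic neighbourhood of \<open>x\<close> restricts only finitely many coordinates, so a
  long enough agreement puts \<open>y\<close> inside it.\<close>

lemma closed_seq_approx:
  fixes S :: "(nat \<Rightarrow> 'b::topological_space) set"
  assumes "closed S" and ex: "\<And>L. \<exists>y\<in>S. agree L x y"
  shows "x \<in> S"
proof (rule ccontr)
  assume "x \<notin> S"
  moreover have "openin (product_topology (\<lambda>i. euclidean) UNIV) (- S)"
    using assms(1) by (simp add: euclidean_product_topology open_Compl)
  ultimately obtain B where B: "x \<in> (\<Pi>\<^sub>E i\<in>UNIV. B i)" "finite {i. B i \<noteq> topspace euclidean}"
      "(\<Pi>\<^sub>E i\<in>UNIV. B i) \<subseteq> - S"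
    using product_topology_open_contains_basis[of "\<lambda>i. euclidean" UNIV "- S" x] by auto
  from B(2) obtain L where L: "\<And>i. B i \<noteq> UNIV \<Longrightarrow> i < L"
    using finite_nat_set_iff_bounded by auto
  obtain y where y: "y \<in> S" "agree L x y" using ex by blast
  have "y i \<in> B i" for i
    using B(1) L[of i] y(2) by (cases "B i = UNIV") (auto simp: agree_def PiE_iff, metis)
  then show False using B(3) y(1) by auto
qed

text \<open>A function space is an instance of \<^class>\<open>t2_space\<close> only over a metric codomain, which
  \<^typ>\<open>nat\<close> is not; so the standard facts on compact sets are redone for sequences.\<close>
lemma compact_imp_closed_seq:
  fixes S :: "(nat \<Rightarrow> 'b::t2_space) set"
  assumes "compact S" shows "closed S"
proof -
  have "Hausdorff_space (product_topology (\<lambda>i::nat. euclidean :: 'b topology) UNIV)"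
    unfolding Hausdorff_space_product_topology
    using hausdorff[where 'a = 'b] by (simp add: Hausdorff_space_def disjnt_def)
  then have "Hausdorff_space (euclidean :: (nat \<Rightarrow> 'b) topology)"
    by (simp add: euclidean_product_topology)
  then show ?thesis using assms compactin_imp_closedin[of euclidean S] by simp
qed

text \<open>Closed subsets of \<open>S\<close> are compact, so their images are compact and hence
  closed: \<open>f\<close> is a closed map onto its image, which yields continuity of
  \<open>g\<close>.\<close>

lemma continuous_on_inv_seq:
  fixes f :: "'a::topological_space \<Rightarrow> nat \<Rightarrow> 'b::t2_space"
  assumes "continuous_on S f" "compact S" "\<And>x. x \<in> S \<Longrightarrow> g (f x) = x"
  shows "continuous_on (f ` S) g"
proof (rule continuous_on_inverse_closed_map[OF assms(1) refl])
  fix U assume U: "closedin (top_of_set S) U"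
  then have "compact U" "U \<subseteq> S"
    using assms(2) by (auto simp: closedin_closed intro: compact_Int_closed)
  then have "closed (f ` U)"
    using assms(1) by (intro compact_imp_closed_seq compact_continuous_image)
      (auto intro: continuous_on_subset)
  then show "closedin (top_of_set (f ` S)) (f ` U)"
    using \<open>U \<subseteq> S\<close> by (intro closed_subset image_mono)
qed (use assms(3) in blast)

lemma homeomorphism_compact_seq:
  fixes f :: "'a::topological_space \<Rightarrow> nat \<Rightarrow> 'b::t2_space"
  assumes "compact S" "continuous_on S f" "f ` S = T" "inj_on f S"
  shows "\<exists>g. homeomorphism S T f g"
proof -
  have inv: "the_inv_into S f (f x) = x" if "x \<in> S" for x
    by (rule the_inv_into_f_f[OF assms(4) that])
  then have "homeomorphism S T f (the_inv_into S f)"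
    unfolding assms(3)[symmetric]
    by (intro homeomorphismI assms(2) continuous_on_inv_seq[OF assms(2,1)]) auto
  then show ?thesis by blast
qed

lemma compact_bounded_seqs: "compact {x :: nat \<Rightarrow> nat. \<forall>i. x i < n}"
proof -
  have "{x :: nat \<Rightarrow> nat. \<forall>i. x i < n} = (\<Pi>\<^sub>E i\<in>UNIV. {..<n})" by (auto simp: PiE_iff)
  moreover have "compactin (product_topology (\<lambda>i. euclidean) UNIV) (\<Pi>\<^sub>E i\<in>(UNIV::nat set). {..<n})"
    by (simp add: compactin_PiE finite_imp_compact)
  ultimately show ?thesis by (simp add: euclidean_product_topology)
qed

lemma continuous_on_shift_pow: "continuous_on S (shift ^^ m :: (nat \<Rightarrow> 'a::topological_space) \<Rightarrow> _)"
  by (intro continuous_on_coordinatewise_then_product)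
     (simp, rule continuous_on_subset[OF continuous_on_product_coordinates], simp)

subsection \<open>Substitutions acting on sequences\<close>

text \<open>The definition reads letter \<open>i\<close> off the image of a prefix whose length
  depends on \<open>i\<close>. Splitting off the first letter turns this into a recursion, the form
  suited to induction over positions.\<close>

lemma subst_seq_unfold:
  assumes ne: "\<And>i. \<theta> (x i) \<noteq> []"
  shows "subst_seq \<theta> x i = (if i < length (\<theta> (x 0)) then \<theta> (x 0) ! i
           else subst_seq \<theta> (shift x) (i - length (\<theta> (x 0))))"
proof -
  define c where "c = (\<lambda>j. concat (map \<theta> (map (shift x) [0..<j])))"
  have len: "j \<le> length (c j)" for j
  proof (induction j)
    case (Suc j)
    have "1 \<le> length (\<theta> (x (Suc j)))" using ne by (simp add: Suc_le_eq)
    with Suc show ?case by (simp add: c_def)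
  qed (simp add: c_def)
  have "map x [0..<Suc i] = x 0 # map (shift x) [0..<i]"
    by (simp add: upt_conv_Cons map_Suc_upt[symmetric] o_def del: upt_Suc)
  then have eq: "subst_seq \<theta> x i = (\<theta> (x 0) @ c i) ! i"
    by (simp add: subst_seq_def c_def del: upt_Suc map_map)
  show ?thesis
  proof (cases "i < length (\<theta> (x 0))")
    case False
    define j where "j = i - length (\<theta> (x 0))"
    have "0 < length (\<theta> (x 0))" using ne by simp
    \<comment> \<open>Since \<open>\<theta> (x 0)\<close> is nonempty, the images of the
      \<open>Suc j\<close> letters after \<open>x 0\<close> form a prefix of \<open>c i\<close>, and
      by \<open>len\<close> this prefix already contains position \<open>j\<close>.\<close>
    with False have "Suc j \<le> i" by (simp add: j_def del: length_greater_0_conv)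
    then have "[0..<i] = [0..<Suc j] @ [Suc j..<i]"
      by (metis le_add_diff_inverse upt_add_eq_append zero_le)
    then have "c i = c (Suc j) @ concat (map \<theta> (map (shift x) [Suc j..<i]))"
      unfolding c_def by (metis concat_append map_append)
    then have "c i ! j = c (Suc j) ! j"
      using len[of "Suc j"] by (simp add: nth_append)
    then show ?thesis using False eq by (simp add: nth_append subst_seq_def c_def j_def del: upt_Suc)
  qed (simp add: eq nth_append)
qed

lemma subst_word_simps [simp]:
  "subst_word \<theta> [] = []" "subst_word \<theta> (a # w) = \<theta> a @ subst_word \<theta> w"
  "subst_word \<theta> (v @ w) = subst_word \<theta> v @ subst_word \<theta> w"
  by (simp_all add: subst_word_def)

lemma subst_pow_simps [simp]:
  "subst_pow \<theta> 0 a = [a]" "subst_pow \<theta> (Suc m) a = subst_word \<theta> (subst_pow \<theta> m a)"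
  by (simp_all add: subst_pow_def)

lemma starts_subst_seq:
  assumes "\<And>i. \<theta> (x i) \<noteq> []" "starts x w"
  shows "starts (subst_seq \<theta> x) (subst_word \<theta> w)"
  using assms
proof (induction w arbitrary: x)
  case (Cons a w)
  then have "x 0 = a" "starts (shift x) w" by (auto simp: starts_Cons)
  moreover from this have "starts (subst_seq \<theta> (shift x)) (subst_word \<theta> w)"
    using Cons.prems(1) Cons.IH[of "shift x"] by (simp add: shift_def)
  ultimately have "starts (subst_seq \<theta> (shift x)) (subst_word \<theta> w)" "x 0 = a" by auto
  then show ?case
    unfolding starts_def using subst_seq_unfold[of \<theta> x, OF Cons.prems(1)]
    by (auto simp: nth_append)
qed simp

text \<open>The first image is counted exactly, and each of the \<open>L\<close> further letters
  contributes at least \<open>r\<close>. The exact first length matters when a part of the first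
  image is cut off afterwards.\<close>

lemma agree_subst_seq:
  assumes "\<And>i. \<theta> (x i) \<noteq> []" "\<And>i. \<theta> (y i) \<noteq> []" "\<And>i. r \<le> length (\<theta> (x i))"
    and "agree (Suc L) x y"
  shows "agree (length (\<theta> (x 0)) + r * L) (subst_seq \<theta> x) (subst_seq \<theta> y)"
  using assms
proof (induction L arbitrary: x y)
  case 0
  then show ?case
    by (simp add: agree_def subst_seq_unfold[of \<theta> x] subst_seq_unfold[of \<theta> y])
next
  case (Suc L)
  have "agree (length (\<theta> (shift x 0)) + r * L) (subst_seq \<theta> (shift x)) (subst_seq \<theta> (shift y))"
    using Suc.IH[of "shift x" "shift y", OF _ _ _ agree_shift[OF Suc.prems(4)]] Suc.prems(1-3)
    by (simp add: shift_def)
  moreover have "r \<le> length (\<theta> (shift x 0))" using Suc.prems(3)[of 1] by simp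
  moreover have "x 0 = y 0" using Suc.prems(4) by (simp add: agree_def)
  ultimately show ?case
    unfolding agree_def
    by (simp add: subst_seq_unfold[of \<theta> x, OF Suc.prems(1)] subst_seq_unfold[of \<theta> y, OF Suc.prems(2)])
qed

lemma fixpts_eqI:
  assumes ne: "\<And>a. a < n \<Longrightarrow> \<theta> a \<noteq> []" and "x \<in> fixpts n \<theta>" "y \<in> fixpts n \<theta>"
    and "x 0 = y 0" "2 \<le> length (\<theta> (x 0))"
  shows "x = y"
proof -
  have x: "subst_seq \<theta> x = x" "\<theta> (x i) \<noteq> []" and y: "subst_seq \<theta> y = y" "\<theta> (y i) \<noteq> []" for i
    using assms by (auto simp: fixpts_def)
  have "agree (Suc L) x y" for L
  proof (induction L)
    case (Suc L)
    have "1 \<le> length (\<theta> (x i))" for i using x(2)[of i] by (simp add: Suc_le_eq)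
    \<comment> \<open>The first image has at least two letters, so agreement on \<open>L + 1\<close>
      letters becomes agreement on at least \<open>L + 2\<close>; the bound \<open>r = 1\<close> is
      enough for the rest.\<close>
    then have "agree (length (\<theta> (x 0)) + 1 * L) (subst_seq \<theta> x) (subst_seq \<theta> y)"
      using Suc x(2) y(2) by (intro agree_subst_seq)
    then show ?case using assms(5) by (simp add: x y agree_def)
  qed (use assms in \<open>simp add: agree_def\<close>)
  then have "x i = y i" for i by (simp add: agree_def) (metis lessI)
  then show ?thesis by blast
qed

lemma fixpts_hd:
  assumes "\<And>a. a < n \<Longrightarrow> \<theta> a \<noteq> []" "x \<in> fixpts n \<theta>"
  shows "hd (\<theta> (x 0)) = x 0"
proof -
  have "\<theta> (x i) \<noteq> []" "subst_seq \<theta> x = x" for i using assms by (auto simp: fixpts_def)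
  then show ?thesis using subst_seq_unfold[of \<theta> x 0] by (simp add: hd_conv_nth)
qed

lemma length_subst_word_ge:
  assumes "\<And>a. a \<in> set w \<Longrightarrow> 2 \<le> length (\<theta> a)"
  shows "2 * length w \<le> length (subst_word \<theta> w)"
  using assms by (induction w) fastforce+

lemma set_subst_word:
  assumes "is_subst n \<theta>" "set w \<subseteq> {..<n}"
  shows "set (subst_word \<theta> w) \<subseteq> {..<n}"
  using assms by (auto simp: subst_word_def is_subst_def)

lemma set_subst_pow:
  assumes "is_subst n \<theta>" "a < n"
  shows "set (subst_pow \<theta> m a) \<subseteq> {..<n}"
  using assms by (induction m) (auto dest: set_subst_word)

lemma length_subst_pow_gt:
  assumes "is_subst n \<theta>" "\<And>a. a < n \<Longrightarrow> 2 \<le> length (\<theta> a)" "a < n"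
  shows "m < length (subst_pow \<theta> m a)"
proof (induction m)
  case (Suc m)
  have "2 * length (subst_pow \<theta> m a) \<le> length (subst_word \<theta> (subst_pow \<theta> m a))"
    using assms set_subst_pow[OF assms(1,3)] by (intro length_subst_word_ge) blast
  with Suc show ?case by simp
qed simp

text \<open>With images of length at least two the words \<open>subst_pow \<theta> m (u 0)\<close>
  grow without bound, so as prefixes of \<open>u\<close> they determine every letter. Conversely,
  applying \<open>\<theta>\<close> repeatedly to a fixed \<open>u\<close> shows that these words are
  prefixes of it.\<close>

lemma gen_fixed_iff_fixpts:
  assumes sub: "is_subst n \<theta>" and len: "\<And>a. a < n \<Longrightarrow> 2 \<le> length (\<theta> a)"
  shows "gen_fixed n \<theta> u \<longleftrightarrow> u \<in> fixpts n \<theta>"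
proof
  have ne: "\<theta> a \<noteq> []" if "a < n" for a using len[OF that] by auto
  { assume g: "gen_fixed n \<theta> u"
    have st: "starts u (subst_pow \<theta> m (u 0))" and u0: "u 0 < n" for m
      using g by (auto simp: gen_fixed_def starts_def)
    have gt: "i < length (subst_pow \<theta> i (u 0))" for i
      using length_subst_pow_gt[OF sub len u0] .
    have less: "u i < n" for i
      using st[of i] gt[of i] set_subst_pow[OF sub u0, of i] nth_mem
      unfolding starts_def by (metis lessThan_iff subsetD)
    have "subst_seq \<theta> u i = u i" for i
    proof -
      have "starts (subst_seq \<theta> u) (subst_pow \<theta> (Suc i) (u 0))"
        using starts_subst_seq[of \<theta> u, OF ne[OF less] st[of i]] by simp
      moreover have "i < length (subst_pow \<theta> (Suc i) (u 0))"
        using gt[of "Suc i"] by linarith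
      ultimately show ?thesis using st[of "Suc i"] by (simp add: starts_def)
    qed
    then show "u \<in> fixpts n \<theta>" using less by (auto simp: fixpts_def) }
  assume f: "u \<in> fixpts n \<theta>"
  then have u: "u i < n" "subst_seq \<theta> u = u" for i by (auto simp: fixpts_def)
  have "starts u (subst_pow \<theta> m (u 0))" for m
  proof (induction m)
    case (Suc m)
    then show ?case using starts_subst_seq[of \<theta> u, OF ne[OF u(1)] Suc] u(2) by simp
  qed (simp add: starts_def)
  then show "gen_fixed n \<theta> u"
    unfolding gen_fixed_def starts_def
    using u ne fixpts_hd[OF ne f] length_subst_pow_gt[OF sub len u(1)[of 0]] by blast
qed

section \<open>The language of a substitution\<close>

lemma lang_infixI: "u @ w @ v \<in> lang n \<theta> \<Longrightarrow> w \<in> lang n \<theta>"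
  unfolding lang_def by (clarsimp, metis append.assoc)

lemma lang_subst_word: "w \<in> lang n \<theta> \<Longrightarrow> subst_word \<theta> w \<in> lang n \<theta>"
proof -
  assume "w \<in> lang n \<theta>"
  then obtain a m u v where "a < n" "subst_pow \<theta> m a = u @ w @ v" by (auto simp: lang_def)
  then have "subst_pow \<theta> (Suc m) a = subst_word \<theta> u @ subst_word \<theta> w @ subst_word \<theta> v" by simp
  then show ?thesis using \<open>a < n\<close> unfolding lang_def by blast
qed

lemma set_lang:
  assumes "is_subst n \<theta>" "w \<in> lang n \<theta>"
  shows "set w \<subseteq> {..<n}"
proof -
  obtain a m u v where "a < n" "subst_pow \<theta> m a = u @ w @ v" using assms(2) by (auto simp: lang_def)
  then show ?thesis using set_subst_pow[OF assms(1), of a m] by auto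
qed

lemma lang_adjacent:
  assumes "w \<in> lang n \<theta>" "Suc j < length w"
  shows "[w ! j, w ! Suc j] \<in> lang n \<theta>"
proof -
  have "w = take j w @ [w ! j, w ! Suc j] @ drop (Suc (Suc j)) w"
    using assms(2) by (simp add: Cons_nth_drop_Suc)
  then show ?thesis using assms(1) lang_infixI by metis
qed

lemma finite_lang_length:
  assumes "is_subst n \<theta>"
  shows "finite {w \<in> lang n \<theta>. length w = l}"
  by (rule finite_subset[OF _ finite_lists_length_eq[of "{..<n}" l]]) (use set_lang[OF assms] in auto)

section \<open>The two-block substitution\<close>

text \<open>The facts about \<open>\<tau>\<close> on which the construction rests. \<open>e\<close>
  numbers the 2-words, so the letters of the new alphabet stand for 2-blocks;
  \<open>fixpt_ex\<close> makes every word of the language occur in a fixed point.\<close>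

locale two_block =
  fixes n N :: nat and \<tau> :: "nat \<Rightarrow> nat list" and e :: "nat list \<Rightarrow> nat"
  assumes subst: "is_subst n \<tau>"
    and hd_tau: "a < n \<Longrightarrow> hd (\<tau> a) = a"
    and length_tau: "a < n \<Longrightarrow> 2 \<le> length (\<tau> a)"
    and fixpt_ex: "a < n \<Longrightarrow> \<exists>u\<in>fixpts n \<tau>. u 0 = a"
    and inj_last: "inj_on (\<lambda>a. last (\<tau> a)) {..<n}"
    and recog: "unilat_recognizable n \<tau>"
    and e_bij: "bij_betw e {w \<in> lang n \<tau>. length w = 2} {..<N}"
begin

abbreviation "T \<equiv> subst_seq \<tau>"
abbreviation "X \<equiv> Xsub n \<tau>"
abbreviation "L2 \<equiv> {w \<in> lang n \<tau>. length w = 2}"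

definition code :: "(nat \<Rightarrow> nat) \<Rightarrow> nat \<Rightarrow> nat" where
  "code x = (\<lambda>i. e [x i, x (Suc i)])"

text \<open>The letter coding (ab) is sent to the 2-windows of \<open>\<tau> a @ [b]\<close>, one
  for each position of \<open>\<tau> a\<close>. As \<open>\<tau> b\<close> begins with
  \<open>b\<close>, these are the 2-windows of \<open>\<tau> a @ \<tau> b\<close> that start inside
  \<open>\<tau> a\<close>.\<close>

definition tau2 :: "nat \<Rightarrow> nat list" where
  "tau2 q = (let w = inv_into L2 e q; v = \<tau> (w ! 0) @ [w ! 1]
             in map (\<lambda>j. e [v ! j, v ! Suc j]) [0..<length (\<tau> (w ! 0))])"

abbreviation "T2 \<equiv> subst_seq tau2"

text \<open>The shift of finite type given by the admissible 2-words. It is closed and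
  shift-invariant and contains \<open>X\<close>, and all identities for \<open>code\<close> and
  \<open>T\<close> already hold on it.\<close>

definition Y :: "(nat \<Rightarrow> nat) set" where
  "Y = {x. \<forall>i. [x i, x (Suc i)] \<in> lang n \<tau>}"

lemma tau_ne: "a < n \<Longrightarrow> \<tau> a \<noteq> []"
  using length_tau by fastforce

lemma tau_0: "a < n \<Longrightarrow> \<tau> a ! 0 = a"
  using hd_tau tau_ne by (simp add: hd_conv_nth)

lemma tau2_code: "[a, b] \<in> lang n \<tau> \<Longrightarrow>
  tau2 (e [a, b]) = map (\<lambda>j. e [(\<tau> a @ [b]) ! j, (\<tau> a @ [b]) ! Suc j]) [0..<length (\<tau> a)]"
  using bij_betw_imp_inj_on[OF e_bij] by (simp add: tau2_def Let_def inv_into_f_f)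

lemma length_tau2: "[a, b] \<in> lang n \<tau> \<Longrightarrow> length (tau2 (e [a, b])) = length (\<tau> a)"
  by (simp add: tau2_code)

lemma e_cases:
  assumes "q < N" obtains a b where "[a, b] \<in> lang n \<tau>" "q = e [a, b]"
proof -
  have "q \<in> e ` L2" using e_bij assms by (auto simp: bij_betw_def)
  then obtain w where "w \<in> lang n \<tau>" "length w = 2" "q = e w" by blast
  then show thesis using that by (cases w; cases "tl w") auto
qed

lemma e_less: "[a, b] \<in> lang n \<tau> \<Longrightarrow> e [a, b] < N"
  using e_bij by (auto simp: bij_betw_def)

lemma e_eq_iff: "[a, b] \<in> lang n \<tau> \<Longrightarrow> [c, d] \<in> lang n \<tau> \<Longrightarrow> e [a, b] = e [c, d] \<longleftrightarrow> a = c \<and> b = d"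
  using inj_on_eq_iff[OF bij_betw_imp_inj_on[OF e_bij], of "[a, b]" "[c, d]"] by simp

lemma lang_less: "[a, b] \<in> lang n \<tau> \<Longrightarrow> a < n" "[a, b] \<in> lang n \<tau> \<Longrightarrow> b < n"
  using set_lang[OF subst] by fastforce+

text \<open>Since \<open>\<tau> b\<close> begins with \<open>b\<close>, the word is a prefix of the
  image of \<open>[a, b]\<close>.\<close>

lemma lang_tau:
  assumes "[a, b] \<in> lang n \<tau>" shows "\<tau> a @ [b] \<in> lang n \<tau>"
proof -
  have "\<tau> b = b # tl (\<tau> b)"
    using tau_ne[OF lang_less(2)[OF assms]] hd_tau[OF lang_less(2)[OF assms]] by (cases "\<tau> b") auto
  then have "[] @ (\<tau> a @ [b]) @ tl (\<tau> b) = subst_word \<tau> [a, b]" by simp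
  then show ?thesis using lang_subst_word[OF assms] lang_infixI by metis
qed

lemma lang_tau_adjacent:
  assumes "[a, b] \<in> lang n \<tau>" "j < length (\<tau> a)"
  shows "[(\<tau> a @ [b]) ! j, (\<tau> a @ [b]) ! Suc j] \<in> lang n \<tau>"
  using lang_adjacent[OF lang_tau[OF assms(1)], of j] assms(2) by simp

lemma is_subst_tau2: "is_subst N tau2"
  unfolding is_subst_def
proof (intro allI impI subsetI)
  fix q c assume "q < N" "c \<in> set (tau2 q)"
  from \<open>q < N\<close> obtain a b where "[a, b] \<in> lang n \<tau>" "q = e [a, b]" by (rule e_cases)
  then show "c \<in> {..<N}"
    using \<open>c \<in> _\<close> lang_tau_adjacent e_less by (auto simp: tau2_code)
qed

lemma length_tau2_ge: "q < N \<Longrightarrow> 2 \<le> length (tau2 q)"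
  by (erule e_cases) (simp add: length_tau2 length_tau lang_less)

lemma tau2_ne: "q < N \<Longrightarrow> tau2 q \<noteq> []"
  using length_tau2_ge by fastforce

lemma last_tau2:
  assumes "[a, b] \<in> lang n \<tau>"
  shows "[last (\<tau> a), b] \<in> lang n \<tau>" "last (tau2 (e [a, b])) = e [last (\<tau> a), b]"
proof -
  have "\<tau> a \<noteq> []" using tau_ne lang_less assms by blast
  then have "length (\<tau> a) - 1 < length (\<tau> a)" "Suc (length (\<tau> a) - 1) = length (\<tau> a)" by auto
  then have eq: "[(\<tau> a @ [b]) ! (length (\<tau> a) - 1), (\<tau> a @ [b]) ! Suc (length (\<tau> a) - 1)]
      = [last (\<tau> a), b]"
    using \<open>\<tau> a \<noteq> []\<close> by (simp add: nth_append last_conv_nth)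
  then show "[last (\<tau> a), b] \<in> lang n \<tau>"
    using lang_tau_adjacent[OF assms, of "length (\<tau> a) - 1"] \<open>\<tau> a \<noteq> []\<close> by simp
  show "last (tau2 (e [a, b])) = e [last (\<tau> a), b]"
    using eq \<open>\<tau> a \<noteq> []\<close> by (simp add: tau2_code assms last_map)
qed

text \<open>The last letter of the image of the block (ab) is the block of
  \<open>last (\<tau> a)\<close> and \<open>b\<close>: it shows \<open>b\<close> directly and
  \<open>a\<close> through \<open>inj_last\<close>. Injectivity on a finite set gives the
  permutation.\<close>

lemma suffix_perm_tau2: "suffix_perm N tau2"
proof -
  have "inj_on (\<lambda>q. last (tau2 q)) {..<N}"
  proof (rule inj_onI)
    fix q r assume "q \<in> {..<N}" "r \<in> {..<N}" and eq: "last (tau2 q) = last (tau2 r)"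
    then obtain a b c d where ab: "[a, b] \<in> lang n \<tau>" "q = e [a, b]"
        and cd: "[c, d] \<in> lang n \<tau>" "r = e [c, d]"
      by (metis e_cases lessThan_iff)
    have "e [last (\<tau> a), b] = e [last (\<tau> c), d]"
      using eq by (simp add: ab cd last_tau2)
    then have "last (\<tau> a) = last (\<tau> c)" "b = d"
      using e_eq_iff[OF last_tau2(1)[OF ab(1)] last_tau2(1)[OF cd(1)]] by auto
    then have "a = c" using inj_last lang_less ab(1) cd(1) by (auto simp: inj_on_def)
    then show "q = r" using \<open>b = d\<close> ab cd by simp
  qed
  moreover have "(\<lambda>q. last (tau2 q)) ` {..<N} \<subseteq> {..<N}"
    using is_subst_tau2 tau2_ne last_in_set unfolding is_subst_def by blast
  ultimately show ?thesis
    unfolding suffix_perm_def bij_betw_def using tau2_ne by (simp add: endo_inj_surj)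
qed

subsection \<open>The 2-block map\<close>

lemma Y_less: "x \<in> Y \<Longrightarrow> x i < n"
  unfolding Y_def using lang_less(1) by blast

lemma Y_ne: "x \<in> Y \<Longrightarrow> \<tau> (x i) \<noteq> []"
  using Y_less tau_ne by blast

lemma Y_shift: "x \<in> Y \<Longrightarrow> shift x \<in> Y"
  by (simp add: Y_def)

lemma closed_Y: "closed Y"
proof -
  have "closed {x :: nat \<Rightarrow> nat. [x i, x (Suc i)] \<in> lang n \<tau>}" for i
  proof -
    have "closed ({p. [fst p, snd p] \<in> lang n \<tau>} :: (nat \<times> nat) set)"
    proof -
      have "open (A :: (nat \<times> nat) set)" for A
        unfolding open_prod_def by (auto intro!: exI[of _ "{_}"] simp: open_discrete)
      then show ?thesis by (simp add: closed_def)
    qed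
    then have "closed ((\<lambda>x :: nat \<Rightarrow> nat. (x i, x (Suc i))) -` {p. [fst p, snd p] \<in> lang n \<tau>})"
      by (rule closed_vimage) (intro continuous_on_Pair continuous_on_product_coordinates)
    then show ?thesis by (simp add: vimage_def)
  qed
  then show ?thesis unfolding Y_def by (rule closed_Collect_all)
qed

lemma code_less: "x \<in> Y \<Longrightarrow> code x i < N"
  by (simp add: code_def Y_def e_less)

lemma code_inj: "inj_on code Y"
proof (rule inj_onI, rule ext)
  fix x y i assume "x \<in> Y" "y \<in> Y" "code x = code y"
  then have "e [x i, x (Suc i)] = e [y i, y (Suc i)]" unfolding code_def by metis
  then show "x i = y i" using \<open>x \<in> Y\<close> \<open>y \<in> Y\<close> by (simp add: e_eq_iff Y_def)
qed

lemma code_shift: "code (shift x) = shift (code x)"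
  by (auto simp: code_def)

lemma continuous_on_code: "continuous_on S code"
proof (rule continuous_on_seqI)
  fix x i show "\<exists>L. \<forall>y\<in>S. agree L x y \<longrightarrow> code y i = code x i"
    by (rule exI[of _ "Suc (Suc i)"]) (simp add: code_def agree_def)
qed

lemma continuous_on_T: "continuous_on S T"
proof (rule continuous_on_seqI)
  fix x :: "nat \<Rightarrow> nat" and i
  have "map y [0..<Suc i] = map x [0..<Suc i]" if "agree (Suc i) x y" for y
    using that by (auto simp: agree_def)
  then show "\<exists>L. \<forall>y\<in>S. agree L x y \<longrightarrow> T y i = T x i"
    unfolding subst_seq_def by metis
qed

lemma T_unfold: "x \<in> Y \<Longrightarrow>
    T x i = (if i < length (\<tau> (x 0)) then \<tau> (x 0) ! i else T (shift x) (i - length (\<tau> (x 0))))"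
  by (rule subst_seq_unfold) (rule Y_ne)

lemma T_shift: "x \<in> Y \<Longrightarrow> (shift ^^ length (\<tau> (x 0))) (T x) = T (shift x)"
  by (rule ext) (simp add: T_unfold)

lemma T_hd: "x \<in> Y \<Longrightarrow> T x 0 = x 0"
  using T_unfold[of x 0] Y_ne[of x 0] tau_0 Y_less by auto

text \<open>The window at the last position of \<open>\<tau> (x 0)\<close> reaches one letter into
  the next image, and that letter is \<open>x 1\<close> by \<open>hd_tau\<close>. This is the letter
  appended in \<open>tau2\<close>.\<close>

lemma code_T_less:
  assumes "x \<in> Y" "i < length (\<tau> (x 0))"
  shows "code (T x) i = tau2 (code x 0) ! i"
proof -
  have "[x 0, x (Suc 0)] \<in> lang n \<tau>" using assms by (simp add: Y_def)
  moreover have "T (shift x) 0 = x (Suc 0)" using T_hd[OF Y_shift[OF assms(1)]] by simp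
  ultimately show ?thesis
    using assms unfolding code_def by (auto simp: tau2_code T_unfold nth_append Suc_less_eq less_Suc_eq
      not_less_eq)
qed

text \<open>Strong induction on the position: both sides drop the same number of letters, because
  \<open>tau2 (code x 0)\<close> is as long as \<open>\<tau> (x 0)\<close>, and continue with the
  shifted point.\<close>

lemma code_T:
  assumes "x \<in> Y" shows "code (T x) = T2 (code x)"
proof
  fix i show "code (T x) i = T2 (code x) i"
    using assms
  proof (induction i arbitrary: x rule: less_induct)
    case (less i)
    have len: "length (tau2 (code x 0)) = length (\<tau> (x 0))"
      using less.prems by (simp add: code_def length_tau2 Y_def)
    have ne: "tau2 (code x j) \<noteq> []" for j using tau2_ne code_less less.prems by blast
    show ?case
    proof (cases "i < length (\<tau> (x 0))")
      case True
      then show ?thesis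
        using subst_seq_unfold[of tau2 "code x", OF ne] code_T_less[OF less.prems] len by simp
    next
      case False
      have "0 < length (\<tau> (x 0))" using Y_ne less.prems by simp
      then have "i - length (\<tau> (x 0)) < i" using False by linarith
      then have "code (T (shift x)) (i - length (\<tau> (x 0))) = T2 (shift (code x)) (i - length (\<tau> (x 0)))"
        using less.IH Y_shift[OF less.prems] code_shift by metis
      moreover have "code (T x) i = code (T (shift x)) (i - length (\<tau> (x 0)))"
        using False by (simp add: code_def T_unfold[OF less.prems] Suc_diff_le)
      ultimately show ?thesis
        using False subst_seq_unfold[of tau2 "code x", OF ne] len by simp
    qed
  qed
qed

subsection \<open>Fixed points and the subshifts\<close>

lemma gen_fixed_tau: "gen_fixed n \<tau> u \<longleftrightarrow> u \<in> fixpts n \<tau>"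
  by (rule gen_fixed_iff_fixpts[OF subst length_tau])

lemma gen_fixed_tau2: "gen_fixed N tau2 u \<longleftrightarrow> u \<in> fixpts N tau2"
  by (rule gen_fixed_iff_fixpts[OF is_subst_tau2 length_tau2_ge])

lemma fixpts_Y:
  assumes "u \<in> fixpts n \<tau>" shows "u \<in> Y"
  unfolding Y_def
proof safe
  fix i
  have g: "gen_fixed n \<tau> u" using assms gen_fixed_tau by blast
  then have u0: "u 0 < n" and u: "\<And>m i. i < length (subst_pow \<tau> m (u 0)) \<Longrightarrow> u i = subst_pow \<tau> m (u 0) ! i"
    by (auto simp: gen_fixed_def)
  obtain m where m: "Suc i < length (subst_pow \<tau> m (u 0))" using g unfolding gen_fixed_def by blast
  have "subst_pow \<tau> m (u 0) = [] @ subst_pow \<tau> m (u 0) @ []" by simp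
  then have "subst_pow \<tau> m (u 0) \<in> lang n \<tau>" unfolding lang_def using u0 by blast
  then show "[u i, u (Suc i)] \<in> lang n \<tau>"
    using lang_adjacent[OF _ m] u[OF m] u[of i m] m by simp
qed

text \<open>If a fixed point of \<open>tau2\<close> starts with the block (ab), comparing first
  letters shows that \<open>b\<close> is the second letter of \<open>\<tau> a\<close>. So (ab) is
  also the first block of the fixed point of \<open>\<tau>\<close> starting with \<open>a\<close>,
  and a fixed point is determined by its first letter.\<close>

lemma fixpts_tau2: "fixpts N tau2 = code ` fixpts n \<tau>"
proof (intro subset_antisym subsetI)
  have img: "code u \<in> fixpts N tau2" if "u \<in> fixpts n \<tau>" for u
    using that fixpts_Y[OF that] code_T[of u] code_less by (auto simp: fixpts_def)
  { fix y assume "y \<in> code ` fixpts n \<tau>"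
    then show "y \<in> fixpts N tau2" using img by blast }
  fix y assume y: "y \<in> fixpts N tau2"
  then have y0: "y 0 < N" by (simp add: fixpts_def)
  then obtain a b where ab: "[a, b] \<in> lang n \<tau>" "y 0 = e [a, b]" by (rule e_cases)
  obtain u where u: "u \<in> fixpts n \<tau>" "u 0 = a" using fixpt_ex lang_less ab by blast
  have len: "2 \<le> length (\<tau> a)" using length_tau lang_less ab by blast
  have "hd (tau2 (y 0)) = y 0" by (rule fixpts_hd[OF tau2_ne y])
  then have "tau2 (y 0) ! 0 = e [a, b]" using tau2_ne[OF y0] ab by (simp add: hd_conv_nth)
  then have "e [(\<tau> a @ [b]) ! 0, (\<tau> a @ [b]) ! Suc 0] = e [a, b]"
    using ab tau_ne[OF lang_less(1)[OF ab(1)]] by (simp add: tau2_code)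
  then have "(\<tau> a @ [b]) ! Suc 0 = b"
    using e_eq_iff[OF lang_tau_adjacent[OF ab(1), of 0] ab(1)] len by (cases "\<tau> a") auto
  then have "\<tau> a ! Suc 0 = b" using len by (simp add: nth_append)
  moreover have "u (Suc 0) = T u (Suc 0)" using u by (simp add: fixpts_def)
  ultimately have "u (Suc 0) = b"
    using T_unfold[OF fixpts_Y[OF u(1)], of "Suc 0"] u len by simp
  then have "y 0 = code u 0" using ab u by (simp add: code_def)
  then have "y = code u"
    by (intro fixpts_eqI[OF tau2_ne y img[OF u(1)]] length_tau2_ge[OF y0])
  then show "y \<in> code ` fixpts n \<tau>" using u by blast
qed

abbreviation "orbits \<equiv> {(shift ^^ m) u | m u. u \<in> fixpts n \<tau>}"

lemma X_eq: "X = closure orbits"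
  by (simp add: Xsub_def gen_fixed_tau)

lemma fixpts_X: "u \<in> fixpts n \<tau> \<Longrightarrow> (shift ^^ m) u \<in> X"
  unfolding X_eq by (rule subsetD[OF closure_subset]) blast

lemma Y_shift_pow: "x \<in> Y \<Longrightarrow> (shift ^^ m) x \<in> Y"
  by (induction m) (auto intro: Y_shift)

lemma X_Y: "x \<in> X \<Longrightarrow> x \<in> Y"
proof -
  have "orbits \<subseteq> Y" using fixpts_Y Y_shift_pow by blast
  then show "x \<in> X \<Longrightarrow> x \<in> Y" unfolding X_eq using closure_minimal closed_Y by blast
qed

lemma closed_X: "closed X"
  by (simp add: Xsub_def)

lemma compact_X: "compact X"
proof -
  have "X = {x. \<forall>i. x i < n} \<inter> X" using X_Y Y_less by auto
  then show ?thesis using compact_Int_closed[OF compact_bounded_seqs closed_X] by metis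
qed

lemma X_shift_pow: "x \<in> X \<Longrightarrow> (shift ^^ m) x \<in> X"
proof -
  have "(shift ^^ m) ((shift ^^ k) u) \<in> X" if "u \<in> fixpts n \<tau>" for k u
    using fixpts_X[OF that, of "m + k"] by (simp add: funpow_add)
  then have "(shift ^^ m) ` closure orbits \<subseteq> X"
    by (intro image_closure_subset continuous_on_shift_pow closed_X) auto
  then show "x \<in> X \<Longrightarrow> (shift ^^ m) x \<in> X" unfolding X_eq by blast
qed

lemma X_shift: "x \<in> X \<Longrightarrow> shift x \<in> X"
  using X_shift_pow[of x 1] by simp

text \<open>Hence \<open>T\<close> maps the shift orbit of a fixed point into itself, and by
  continuity it preserves \<open>X\<close>.\<close>

lemma T_shift_pow:
  assumes "x \<in> Y" shows "\<exists>k. T ((shift ^^ m) x) = (shift ^^ k) (T x)"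
proof (induction m)
  case 0 show ?case by (rule exI[of _ 0]) simp
next
  case (Suc m)
  then obtain k where "T ((shift ^^ m) x) = (shift ^^ k) (T x)" by blast
  moreover have "T ((shift ^^ Suc m) x) = (shift ^^ length (\<tau> ((shift ^^ m) x 0))) (T ((shift ^^ m) x))"
    using T_shift[OF Y_shift_pow[OF assms, of m]] by simp
  ultimately show ?case by (metis funpow_add o_apply)
qed

lemma X_T: "x \<in> X \<Longrightarrow> T x \<in> X"
proof -
  have "T ((shift ^^ k) u) \<in> X" if "u \<in> fixpts n \<tau>" for k u
    using T_shift_pow[OF fixpts_Y[OF that], of k] fixpts_X[OF that] that by (auto simp: fixpts_def)
  then have "T ` closure orbits \<subseteq> X"
    by (intro image_closure_subset continuous_on_T closed_X) auto
  then show "x \<in> X \<Longrightarrow> T x \<in> X" unfolding X_eq by blast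
qed

lemma code_shift_pow: "code ((shift ^^ m) x) = (shift ^^ m) (code x)"
  by (auto simp: code_def)

lemma Xsub_tau2: "Xsub N tau2 = code ` X"
proof -
  have eq: "Xsub N tau2 = closure (code ` orbits)"
  proof -
    have "{(shift ^^ m) u | m u. gen_fixed N tau2 u} = code ` orbits"
    proof (intro subset_antisym subsetI)
      fix y assume "y \<in> {(shift ^^ m) u | m u. gen_fixed N tau2 u}"
      then obtain m u where "u \<in> fixpts n \<tau>" "y = (shift ^^ m) (code u)"
        by (auto simp: gen_fixed_tau2 fixpts_tau2)
      then show "y \<in> code ` orbits"
        by (intro image_eqI[of _ _ "(shift ^^ m) u"]) (auto simp: code_shift_pow)
    next
      fix y assume "y \<in> code ` orbits"
      then obtain m u where "u \<in> fixpts n \<tau>" "y = (shift ^^ m) (code u)"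
        by (auto simp: code_shift_pow)
      then show "y \<in> {(shift ^^ m) u | m u. gen_fixed N tau2 u}"
        unfolding gen_fixed_tau2 fixpts_tau2 by blast
    qed
    then show ?thesis by (simp add: Xsub_def)
  qed
  have "closed (code ` X)"
    by (intro compact_imp_closed_seq compact_continuous_image continuous_on_code compact_X)
  moreover have "code ` orbits \<subseteq> code ` X" using fixpts_X by blast
  ultimately have "closure (code ` orbits) \<subseteq> code ` X" by (rule closure_minimal[rotated])
  moreover have "code ` X \<subseteq> closure (code ` orbits)"
    unfolding X_eq by (intro image_closure_subset continuous_on_code closure_subset closed_closure)
  ultimately show ?thesis using eq by blast
qed

lemma code_homeomorphism: "\<exists>g. homeomorphism X (Xsub N tau2) code g"
proof (intro homeomorphism_compact_seq compact_X continuous_on_code)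
  show "inj_on code X" using X_Y by (intro inj_on_subset[OF code_inj]) auto
qed (simp add: Xsub_tau2)

lemma branch_point_code:
  assumes "branch_point X x k" shows "branch_point (Xsub N tau2) (code x) k"
proof -
  have x: "x \<in> X" and k: "2 \<le> k" and fin: "finite {y \<in> X. shift y = x}" "card {y \<in> X. shift y = x} = k"
    using assms by (auto simp: branch_point_def)
  have "{y \<in> Xsub N tau2. shift y = code x} = code ` {y \<in> X. shift y = x}"
  proof -
    \<comment> \<open>Every preimage of \<open>code x\<close> has the form \<open>code y\<close>,
      and injectivity of \<open>code\<close> makes \<open>y\<close> a preimage of
      \<open>x\<close>.\<close>
    have "shift y = x" if "y \<in> X" "shift (code y) = code x" for y
      using that x code_shift code_inj X_Y X_shift by (metis inj_onD)
    then show ?thesis by (auto simp: Xsub_tau2 code_shift[symmetric])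
  qed
  moreover have "inj_on code {y \<in> X. shift y = x}"
    using X_Y by (intro inj_on_subset[OF code_inj]) auto
  ultimately show ?thesis
    using x k fin by (simp add: branch_point_def card_image) (simp add: Xsub_tau2)
qed

text \<open>The word occurs in some power image of a letter \<open>c\<close>, which is a prefix of
  the fixed point starting with \<open>c\<close>; shifting that point to the occurrence gives
  \<open>x\<close>.\<close>

lemma lang_occurs:
  assumes "[a, b] \<in> lang n \<tau>" obtains x where "x \<in> X" "x 0 = a" "x (Suc 0) = b"
proof -
  obtain c m u v where c: "c < n" "subst_pow \<tau> m c = u @ [a, b] @ v"
    using assms by (auto simp: lang_def)
  obtain y where y: "y \<in> fixpts n \<tau>" "y 0 = c" using fixpt_ex c by blast
  then have "y i = (u @ [a, b] @ v) ! i" if "i < length (u @ [a, b] @ v)" for i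
    using that gen_fixed_tau[of y] c unfolding gen_fixed_def by metis
  from this[of "length u"] this[of "Suc (length u)"]
  have "y (length u) = a" "y (Suc (length u)) = b" by (auto simp: nth_append)
  then show thesis using that[OF fixpts_X[OF y(1), of "length u"]] by simp
qed

section \<open>Desubstitution by recognizability\<close>

definition desub :: "(nat \<Rightarrow> nat) \<Rightarrow> nat \<times> (nat \<Rightarrow> nat)" where
  "desub x = (THE (k, y). y \<in> X \<and> k < length (\<tau> (y 0)) \<and> x = (shift ^^ k) (T y))"

text \<open>For \<open>x\<close> in \<open>X\<close>, \<open>D x\<close> is the desubstituted point,
  and \<open>\<kappa> x\<close> is the place of the first letter of \<open>x\<close> inside the
  image of the first letter of \<open>D x\<close>.\<close>

definition D :: "(nat \<Rightarrow> nat) \<Rightarrow> nat \<Rightarrow> nat" where "D x = snd (desub x)"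
definition \<kappa> :: "(nat \<Rightarrow> nat) \<Rightarrow> nat" where "\<kappa> x = fst (desub x)"

lemma D_props:
  assumes "x \<in> X"
  shows "D x \<in> X" "\<kappa> x < length (\<tau> (D x 0))" "x = (shift ^^ \<kappa> x) (T (D x))"
proof -
  have "\<exists>!p. case p of (k, y) \<Rightarrow> y \<in> X \<and> k < length (\<tau> (y 0)) \<and> x = (shift ^^ k) (T y)"
    using recog assms unfolding unilat_recognizable_def by blast
  from theI'[OF this] show "D x \<in> X" "\<kappa> x < length (\<tau> (D x 0))" "x = (shift ^^ \<kappa> x) (T (D x))"
    by (auto simp: D_def \<kappa>_def desub_def split: prod.splits)
qed

lemma desub_eqI:
  assumes "y \<in> X" "k < length (\<tau> (y 0))"
  shows "desub ((shift ^^ k) (T y)) = (k, y)"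
proof -
  let ?x = "(shift ^^ k) (T y)"
  have "?x \<in> X" using assms X_T X_shift_pow by blast
  then have "\<exists>!p. case p of (l, z) \<Rightarrow> z \<in> X \<and> l < length (\<tau> (z 0)) \<and> ?x = (shift ^^ l) (T z)"
    using recog unfolding unilat_recognizable_def by blast
  then show ?thesis unfolding desub_def by (rule the1_equality) (use assms in auto)
qed

lemma D_eqI:
  assumes "y \<in> X" "k < length (\<tau> (y 0))"
  shows "D ((shift ^^ k) (T y)) = y" "\<kappa> ((shift ^^ k) (T y)) = k"
  using desub_eqI[OF assms] by (simp_all add: D_def \<kappa>_def)

lemma D_pow_X: "x \<in> X \<Longrightarrow> (D ^^ i) x \<in> X"
  by (induction i) (auto intro: D_props)

text \<open>\<^term>\<open>desub\<close> inverts a continuous bijection defined on a compact space.\<close>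
lemma continuous_on_desub: "continuous_on X desub"
proof -
  \<comment> \<open>The admissible pairs split into finitely many compact pieces, on each of which
    \<open>k\<close> and the first letter of \<open>y\<close> are constant. There \<open>F\<close>
    is a fixed power of the shift after \<open>T\<close>, hence continuous.\<close>
  define K where "K a k = ({k} :: nat set) \<times> (X \<inter> {y. y 0 = a})" for a k
  define I where "I = (SIGMA a:{..<n}. {..<length (\<tau> a)})"
  define U where "U = (\<Union>(a, k)\<in>I. K a k)"
  define F where "F = (\<lambda>(k, y). (shift ^^ k) (T y))"
  have cK: "compact (K a k)" and clK: "closed (K a k)" for a k
  proof -
    have "closed ((\<lambda>y :: nat \<Rightarrow> nat. y 0) -` {a})"
      by (rule closed_vimage[OF closed_singleton continuous_on_product_coordinates])
    then have "closed {y :: nat \<Rightarrow> nat. y 0 = a}" by (simp add: vimage_def)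
    then show "compact (K a k)" "closed (K a k)"
      unfolding K_def
      by (auto intro!: compact_Times compact_Int_closed compact_X closed_Times closed_Int closed_X)
  qed
  have fin: "finite I" by (simp add: I_def)
  have cont: "continuous_on (K a k) F" for a k
  proof -
    have "continuous_on (K a k) (\<lambda>p. (shift ^^ k) (T (snd p)))"
      by (intro continuous_on_compose2[OF continuous_on_shift_pow[of UNIV]]
          continuous_on_compose2[OF continuous_on_T[of UNIV]] continuous_intros) auto
    then show ?thesis
      by (rule continuous_on_eq) (auto simp: K_def F_def)
  qed
  have "continuous_on U F"
    unfolding U_def using fin cont clK
    by (intro continuous_on_closed_Union) auto
  moreover have "compact U" unfolding U_def using fin cK by (auto intro: compact_UN)
  moreover have U: "U = {(k, y). y \<in> X \<and> k < length (\<tau> (y 0))}"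
    using X_Y Y_less by (auto simp: U_def K_def I_def)
  moreover have "\<forall>p\<in>U. desub (F p) = p" unfolding U F_def using desub_eqI by auto
  ultimately have "continuous_on (F ` U) desub" by (intro continuous_on_inv_seq) blast+
  moreover have "X \<subseteq> F ` U"
  proof
    fix x assume "x \<in> X"
    from D_props[OF this] show "x \<in> F ` U"
      unfolding U F_def by (intro image_eqI[of _ _ "(\<kappa> x, D x)"]) auto
  qed
  ultimately show ?thesis by (rule continuous_on_subset)
qed

lemma continuous_on_D: "continuous_on X D"
  unfolding D_def by (intro continuous_intros continuous_on_desub)

lemma continuous_on_kappa: "continuous_on X \<kappa>"
  unfolding \<kappa>_def by (intro continuous_intros continuous_on_desub)

lemma continuous_on_D_pow: "continuous_on X (D ^^ i)"
proof (induction i)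
  case (Suc i)
  then show ?case
    using continuous_on_compose2[OF continuous_on_D Suc] D_pow_X by (auto simp: o_def)
qed simp

subsection \<open>The path of a point\<close>

text \<open>The vertex of edge \<open>i\<close> is the first 2-block of the \<open>i\<close>-th
  desubstitution. Its index is the \<open>\<kappa>\<close> of the level below, since that is where
  the lower block sits in the image; the bottom edge is the only one into its vertex and has index
  0.\<close>

definition path_of :: "(nat \<Rightarrow> nat) \<Rightarrow> nat \<Rightarrow> nat \<times> nat" where
  "path_of x i = (code ((D ^^ i) x) 0, case i of 0 \<Rightarrow> 0 | Suc j \<Rightarrow> \<kappa> ((D ^^ j) x))"

abbreviation "P \<equiv> bratteli_paths N tau2"

lemma length_tau2_code: "x \<in> X \<Longrightarrow> length (tau2 (code x 0)) = length (\<tau> (x 0))"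
  using X_Y by (auto simp: code_def length_tau2 Y_def)

text \<open>This is the source condition that makes consecutive edges of \<open>path_of x\<close>
  fit together.\<close>

lemma code_desub: "x \<in> X \<Longrightarrow> code x 0 = tau2 (code (D x) 0) ! \<kappa> x"
  using code_T_less[of "D x" "\<kappa> x"] D_props[of x] X_Y code_shift_pow
  by (metis add.right_neutral funpow_shift_apply)

lemma path_P: "x \<in> X \<Longrightarrow> path_of x \<in> P"
  unfolding bratteli_paths_def path_of_def
  using code_less X_Y D_pow_X[of x] length_tau2_code D_props code_desub[OF D_pow_X, symmetric] by auto

lemma continuous_on_path: "continuous_on X path_of"
proof (rule continuous_on_coordinatewise_then_product)
  fix i
  have c: "continuous_on X (\<lambda>x. (D ^^ i) x j)" for i j
    by (rule continuous_on_product_then_coordinatewise[OF continuous_on_D_pow])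
  have "continuous_on X (\<lambda>x. \<kappa> ((D ^^ j) x))" for j
    using D_pow_X by (intro continuous_on_compose2[OF continuous_on_kappa continuous_on_D_pow]) auto
  then have "continuous_on X (\<lambda>x. case i of 0 \<Rightarrow> 0 | Suc j \<Rightarrow> \<kappa> ((D ^^ j) x))"
    by (cases i) auto
  then show "continuous_on X (\<lambda>x. path_of x i)"
    unfolding path_of_def code_def
    by (intro continuous_on_Pair continuous_on_discrete_binary[OF c c, where F = "\<lambda>a b. e [a, b]"])
qed

text \<open>Each vertex fixes two letters at its level. The induction gains one letter at level
  \<open>i\<close> from the agreement known at level \<open>i + 1\<close>, and so treats all levels
  together.\<close>

lemma path_eq_imp_agree:
  assumes "x \<in> X" "y \<in> X" "path_of x = path_of y"
  shows "agree (m + 2) ((D ^^ i) x) ((D ^^ i) y)"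
proof (induction m arbitrary: i)
  case 0
  have "code ((D ^^ i) x) 0 = code ((D ^^ i) y) 0"
    using fun_cong[OF assms(3), of i] by (simp add: path_of_def)
  then show ?case
    using X_Y[OF D_pow_X[OF assms(1)], of i] X_Y[OF D_pow_X[OF assms(2)], of i]
    by (auto simp: code_def e_eq_iff Y_def agree_def less_Suc_eq numeral_2_eq_2)
next
  case (Suc m)
  define x' y' k where "x' = D ((D ^^ i) x)" "y' = D ((D ^^ i) y)" "k = \<kappa> ((D ^^ i) x)"
  note defs = this
  have k: "\<kappa> ((D ^^ i) y) = k"
    using fun_cong[OF assms(3), of "Suc i"] by (simp add: path_of_def defs)
  note dx = D_props[OF D_pow_X[OF assms(1), of i], folded defs]
  note dy = D_props[OF D_pow_X[OF assms(2), of i], folded defs, unfolded k]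
  have "agree (Suc (m + 1)) x' y'" using Suc[of "Suc i"] by (simp add: defs)
  then have "agree (length (\<tau> (x' 0)) + 2 * (m + 1)) (T x') (T y')"
    using X_Y[OF dx(1)] X_Y[OF dy(1)] Y_ne Y_less length_tau by (intro agree_subst_seq) auto
  \<comment> \<open>The cut \<open>k\<close> is smaller than the first image length, so at least
    \<open>2 * m + 3\<close> letters remain. This covers even the maximal cut, which leaves one
    letter of the first image.\<close>
  then have "agree (Suc m + 2) ((shift ^^ k) (T x')) ((shift ^^ k) (T y'))"
    using dx(2) by (auto simp: agree_def)
  then show ?case unfolding dx(3)[symmetric] dy(3)[symmetric] .
qed

lemma path_inj: "inj_on path_of X"
proof (rule inj_onI, rule ext)
  fix x y i assume "x \<in> X" "y \<in> X" "path_of x = path_of y"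
  from path_eq_imp_agree[OF this, of i 0] show "x i = y i" by (simp add: agree_def)
qed

text \<open>A finite piece of a path is realized from the top down: take any point showing the top
  2-block, then repeatedly apply \<open>T\<close> and shift by the prescribed edge index.
  Recognizability ensures that \<open>D\<close> and \<open>\<kappa>\<close> undo each such
  step.\<close>

lemma path_approx:
  assumes p: "p \<in> P"
  shows "\<exists>x\<in>X. agree (Suc m) p (path_of x)"
proof -
  have p_less: "fst (p i) < N" and p0: "snd (p 0) = 0" for i
    using p by (auto simp: bratteli_paths_def)
  have pS: "snd (p (Suc i)) < length (tau2 (fst (p (Suc i))))"
      "tau2 (fst (p (Suc i))) ! snd (p (Suc i)) = fst (p i)" for i
    using p by (auto simp: bratteli_paths_def)
  \<comment> \<open>Generalizing over the starting level \<open>i\<close> lets the induction on the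
    number \<open>l\<close> of levels take its point from level \<open>i + 1\<close>.\<close>
  have "\<exists>x\<in>X. code x 0 = fst (p i) \<and> (\<forall>j\<le>l. code ((D ^^ j) x) 0 = fst (p (i + j)))
      \<and> (\<forall>j<l. \<kappa> ((D ^^ j) x) = snd (p (Suc (i + j))))" for i l
  proof (induction l arbitrary: i)
    case 0
    obtain a b where "[a, b] \<in> lang n \<tau>" "fst (p i) = e [a, b]"
      using p_less[of i] by (rule e_cases)
    then show ?case using lang_occurs[of a b] by (auto simp: code_def)
  next
    case (Suc l)
    obtain y where y: "y \<in> X" "\<And>j. j \<le> l \<Longrightarrow> code ((D ^^ j) y) 0 = fst (p (Suc i + j))"
        "\<And>j. j < l \<Longrightarrow> \<kappa> ((D ^^ j) y) = snd (p (Suc (Suc i + j)))"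
      using Suc[of "Suc i"] by blast
    define k where "k = snd (p (Suc i))"
    define x where "x = (shift ^^ k) (T y)"
    have y0: "code y 0 = fst (p (Suc i))" using y(2)[of 0] by simp
    then have k: "k < length (\<tau> (y 0))" using pS(1)[of i] length_tau2_code[OF y(1)] by (simp add: k_def)
    note D = D_eqI[OF y(1) k, folded x_def]
    have x: "x \<in> X" unfolding x_def using y(1) X_T X_shift_pow by blast
    have "code x 0 = fst (p i)" using code_desub[OF x] D y0 pS(2)[of i] by (simp add: k_def)
    moreover have "code ((D ^^ j) x) 0 = fst (p (i + j))" if "j \<le> Suc l" for j
      using that y(2) \<open>code x 0 = _\<close> by (cases j) (auto simp: funpow_swap1 D simp del: funpow.simps simp: funpow_Suc_right)
    moreover have "\<kappa> ((D ^^ j) x) = snd (p (Suc (i + j)))" if "j < Suc l" for j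
      using that y(3) by (cases j) (auto simp: D k_def simp del: funpow.simps(2) simp: funpow_Suc_right)
    ultimately show ?case using x by blast
  qed
  from this[of 0 m] obtain x where x: "x \<in> X" "\<forall>j\<le>m. code ((D ^^ j) x) 0 = fst (p j)"
      "\<forall>j<m. \<kappa> ((D ^^ j) x) = snd (p (Suc j))" by auto
  have "p i = path_of x i" if "i < Suc m" for i
    using that x p0 by (cases i) (auto simp: path_of_def prod_eq_iff simp del: funpow.simps(2))
  then show ?thesis using x(1) by (auto simp: agree_def)
qed

text \<open>The image is compact, hence closed, so realizing all finite initial pieces of a path
  suffices.\<close>

lemma path_image: "path_of ` X = P"
proof (intro subset_antisym subsetI)
  fix p assume p: "p \<in> P"
  show "p \<in> path_of ` X"
  proof (rule closed_seq_approx)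
    show "closed (path_of ` X)"
      by (intro compact_imp_closed_seq compact_continuous_image continuous_on_path compact_X)
    show "\<exists>q\<in>path_of ` X. agree L p q" for L
      using path_approx[OF p, of L] by (fastforce simp: agree_def)
  qed
qed (use path_P in auto)

subsection \<open>The Vershik map\<close>

lemma desub_shift_less:
  assumes "x \<in> X" "Suc (\<kappa> x) < length (\<tau> (D x 0))"
  shows "D (shift x) = D x" "\<kappa> (shift x) = Suc (\<kappa> x)"
proof -
  have "shift x = (shift ^^ Suc (\<kappa> x)) (T (D x))" using D_props(3)[OF assms(1)] by (metis funpow.simps(2) o_apply)
  then show "D (shift x) = D x" "\<kappa> (shift x) = Suc (\<kappa> x)"
    using D_eqI[OF D_props(1)[OF assms(1)] assms(2)] by simp_all
qed

text \<open>The carry of an odometer: the shift leaves the last letter of the current image, so the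
  position returns to 0 and the shift passes on to the desubstituted point.\<close>

lemma desub_shift_max:
  assumes "x \<in> X" "Suc (\<kappa> x) = length (\<tau> (D x 0))"
  shows "shift x = T (shift (D x))" "D (shift x) = shift (D x)" "\<kappa> (shift x) = 0"
proof -
  have Dx: "D x \<in> X" by (rule D_props(1)[OF assms(1)])
  have "shift x = (shift ^^ Suc (\<kappa> x)) (T (D x))" using D_props(3)[OF assms(1)] by (metis funpow.simps(2) o_apply)
  then show eq: "shift x = T (shift (D x))"
    using T_shift[OF X_Y[OF Dx]] assms(2) by simp
  have S: "shift (D x) \<in> X" using X_shift Dx by blast
  have "0 < length (\<tau> (shift (D x) 0))" using Y_ne[OF X_Y[OF S], of 0] by simp
  from D_eqI[OF S this] show "D (shift x) = shift (D x)" "\<kappa> (shift x) = 0" unfolding eq by (simp_all add: shift_def)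
qed

lemma max_edge_path:
  "x \<in> X \<Longrightarrow> max_edge tau2 (Suc i) (path_of x (Suc i))
     \<longleftrightarrow> Suc (\<kappa> ((D ^^ i) x)) = length (\<tau> (D ((D ^^ i) x) 0))"
  using D_pow_X[of x "Suc i"] by (simp add: max_edge_def path_of_def length_tau2_code)

text \<open>The carry runs through the maximal levels and stops at the first non-maximal one, where
  the index grows by one; the reset levels below form the minimal path.\<close>

lemma path_shift:
  assumes x: "x \<in> X" and nm: "\<not> max_path tau2 (path_of x)"
  shows "path_of (shift x) = vershik tau2 (path_of x)"
proof -
  define k where "k = (LEAST i. \<not> max_edge tau2 i (path_of x i))"
  have "\<exists>i. \<not> max_edge tau2 i (path_of x i)" using nm by (simp add: max_path_def)
  then have nmk: "\<not> max_edge tau2 k (path_of x k)" unfolding k_def by (rule LeastI_ex)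
  \<comment> \<open>The edge with index 0 counts as maximal, so \<open>k\<close> is a successor, and
    the index of edge \<open>Suc l\<close> is the \<open>\<kappa>\<close> of the \<open>l\<close>-th
    desubstitution.\<close>
  then obtain l where l: "k = Suc l" by (cases k) (auto simp: max_edge_def)
  have mx: "Suc (\<kappa> ((D ^^ i) x)) = length (\<tau> (D ((D ^^ i) x) 0))" if "i < l" for i
    using not_less_Least[of "Suc i" "\<lambda>i. \<not> max_edge tau2 i (path_of x i)"] that l max_edge_path[OF x]
    by (simp add: k_def)
  define y where "y = (D ^^ l) x"
  have y: "y \<in> X" unfolding y_def by (rule D_pow_X[OF x])
  have lt: "Suc (\<kappa> y) < length (\<tau> (D y 0))"
    using nmk max_edge_path[OF x, of l] D_props(2)[OF y] by (simp add: l y_def)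
  \<comment> \<open>As long as the levels below are maximal, the carry reaches level
    \<open>i\<close> and the shift acts there.\<close>
  have low: "(D ^^ i) (shift x) = shift ((D ^^ i) x)" if "i \<le> l" for i
    using that
  proof (induction i)
    case (Suc i)
    then show ?case using desub_shift_max(2)[OF D_pow_X[OF x] mx[of i]] by (simp add: shift_def)
  qed simp
  have lowk: "\<kappa> ((D ^^ i) (shift x)) = 0" if "i < l" for i
    using that low[of i] desub_shift_max(3)[OF D_pow_X[OF x] mx[of i]] by simp
  have Dl: "(D ^^ l) (shift x) = shift y" using low by (simp add: y_def)
  \<comment> \<open>At level \<open>l\<close> the shift stays inside one image and is absorbed: all
    further desubstitutions are unchanged.\<close>
  have high: "(D ^^ (Suc l + i)) (shift x) = (D ^^ (Suc l + i)) x" for i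
    by (induction i) (use Dl desub_shift_less(1)[OF y lt] in \<open>simp_all add: y_def shift_def\<close>)
  define s where "s = tau2 (fst (path_of x k)) ! Suc (snd (path_of x k))"
  have s: "code (shift y) 0 = s"
  proof -
    have "code (shift y) 0 = tau2 (code (D (shift y)) 0) ! \<kappa> (shift y)"
      by (rule code_desub[OF X_shift[OF y]])
    then show ?thesis using desub_shift_less[OF y lt] by (simp add: s_def path_of_def l y_def)
  qed
  \<comment> \<open>Here \<open>m\<close> counts the levels below \<open>l\<close>. Each step down
    is at position 0 of an image, so the lower block is the head of the image of the upper
    one.\<close>
  have low_code: "code (shift ((D ^^ (l - m)) x)) 0 = ((\<lambda>b. hd (tau2 b)) ^^ m) s" if "m \<le> l" for m
    using that
  proof (induction m)
    case 0 then show ?case using s by (simp add: y_def shift_def)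
  next
    case (Suc m)
    define i where "i = l - Suc m"
    have i: "i < l" "Suc i = l - m" using Suc.prems by (auto simp: i_def)
    note dm = desub_shift_max[OF D_pow_X[OF x] mx[OF i(1)]]
    have z: "shift ((D ^^ i) x) \<in> X" "shift (D ((D ^^ i) x)) \<in> X"
      using X_shift D_pow_X[OF x] D_props(1) by blast+
    have "tau2 (code (shift (D ((D ^^ i) x))) 0) \<noteq> []" using tau2_ne code_less X_Y z(2) by blast
    then have "code (shift ((D ^^ i) x)) 0 = hd (tau2 (code (shift (D ((D ^^ i) x))) 0))"
      using code_desub[OF z(1)] dm by (simp add: hd_conv_nth)
    also have "code (shift (D ((D ^^ i) x))) 0 = ((\<lambda>b. hd (tau2 b)) ^^ m) s"
      using Suc i(2)[symmetric] by (simp add: shift_def)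
    finally show ?case by (simp add: i_def)
  qed
  show ?thesis
  proof
    fix i
    have v: "vershik tau2 (path_of x) i = (if k < i then path_of x i
        else if i = k then (fst (path_of x k), Suc (snd (path_of x k)))
        else (((\<lambda>b. hd (tau2 b)) ^^ (k - 1 - i)) s, 0))" for i
      by (simp add: vershik_def Let_def k_def[symmetric] s_def)
    consider "k < i" | "i = k" | "i < k" by linarith
    then show "path_of (shift x) i = vershik tau2 (path_of x) i"
    proof cases
      case 1
      then obtain j where j: "i = Suc (Suc l + j)" using l less_imp_Suc_add[of k i] by auto
      show ?thesis using 1 high[of j] high[of "Suc j"] by (simp add: v path_of_def j)
    next
      case 2
      then show ?thesis
        using high[of 0] Dl desub_shift_less(2)[OF y lt] by (simp add: v path_of_def l y_def)
    next
      case 3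
      then have "i \<le> l" using l by simp
      then have "code ((D ^^ i) (shift x)) 0 = ((\<lambda>b. hd (tau2 b)) ^^ (l - i)) s"
        using low low_code[of "l - i"] by simp
      moreover have "(case i of 0 \<Rightarrow> 0 | Suc j \<Rightarrow> \<kappa> ((D ^^ j) (shift x))) = 0"
        using lowk \<open>i \<le> l\<close> by (auto split: nat.split)
      ultimately show ?thesis using 3 l by (simp add: v path_of_def)
    qed
  qed
qed

lemma vershik_conjugacy:
  "\<exists>V. continuous_on P V \<and> V ` P \<subseteq> P \<and> (\<forall>p\<in>P. \<not> max_path tau2 p \<longrightarrow> V p = vershik tau2 p)
     \<and> (\<exists>h g. homeomorphism (Xsub N tau2) P h g \<and> (\<forall>x\<in>Xsub N tau2. h (shift x) = V (h x)))"
proof -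
  obtain g where g: "homeomorphism X P path_of g"
    using homeomorphism_compact_seq[OF compact_X continuous_on_path path_image path_inj] by blast
  obtain c where c: "homeomorphism X (Xsub N tau2) code c" using code_homeomorphism by blast
  \<comment> \<open>The shift transported to paths is defined and continuous on all of
    \<open>P\<close>, maximal paths included; \<open>path_shift\<close> makes it an extension of the
    Vershik map.\<close>
  define V where "V = path_of \<circ> shift \<circ> g"
  have gX: "g p \<in> X" "path_of (g p) = p" if "p \<in> P" for p
    using g that by (auto simp: homeomorphism_def)
  have "continuous_on P V"
    unfolding V_def
  proof (intro continuous_on_compose)
    show "continuous_on P g" using g by (simp add: homeomorphism_def)
    show "continuous_on (g ` P) shift" using continuous_on_shift_pow[of _ 1] by simp
    show "continuous_on (shift ` g ` P) path_of"
      using gX X_shift by (intro continuous_on_subset[OF continuous_on_path]) auto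
  qed
  moreover have "V ` P \<subseteq> P" using gX X_shift path_P by (auto simp: V_def)
  moreover have "\<forall>p\<in>P. \<not> max_path tau2 p \<longrightarrow> V p = vershik tau2 p"
    using gX path_shift by (simp add: V_def)
  moreover have "homeomorphism (Xsub N tau2) P (path_of \<circ> c) (code \<circ> g)"
    using homeomorphism_compose[OF homeomorphism_symD[OF c] g] .
  moreover have "(path_of \<circ> c) (shift x) = V ((path_of \<circ> c) x)" if "x \<in> Xsub N tau2" for x
  proof -
    have cX: "c x \<in> X" "code (c x) = x" using c that by (auto simp: homeomorphism_def)
    then have "c (shift x) = shift (c x)"
      using c X_shift code_shift by (metis homeomorphism_def)
    then show ?thesis using cX g by (simp add: V_def homeomorphism_def)
  qed
  ultimately show ?thesis by blast
qed

end

section \<open>From the standing assumptions to the two-block setting\<close>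

text \<open>If \<open>\<tau> a = [a]\<close>, all powers fix \<open>[a]\<close> and primitivity
  leaves \<open>a\<close> as the only letter. Then no power image is longer than 1, there is no
  generating fixed point, and the subshift is empty instead of infinite.\<close>

lemma standing_image_ne_singleton:
  assumes "standing n \<tau>" "a < n" shows "\<tau> a \<noteq> [a]"
proof
  assume a: "\<tau> a = [a]"
  then have pow: "subst_pow \<tau> m a = [a]" for m by (induction m) auto
  obtain m where "\<forall>a<n. \<forall>b<n. b \<in> set (subst_pow \<tau> m a)"
    using assms(1) by (auto simp: standing_def primitive_def)
  then have "b = a" if "b < n" for b using that assms(2) pow by fastforce
  then have "\<not> gen_fixed n \<tau> u" for u
    unfolding gen_fixed_def using pow by (metis less_irrefl length_Cons list.size(3) One_nat_def)
  then have "Xsub n \<tau> = {}" by (simp add: Xsub_def)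
  then show False using assms(1) by (simp add: standing_def)
qed

theorem theorem19:
  fixes n N :: nat and \<tau> :: "nat \<Rightarrow> nat list" and k :: "nat \<Rightarrow> nat"
  assumes "standing n \<tau>"
    and "prefix_perm n \<tau>" and "suffix_perm n \<tau>"
    and "\<exists>p. bij_betw p {..<n} (fixpts n \<tau>) \<and> (\<forall>i<n. branch_point (Xsub n \<tau>) (p i) (k i))"
    and "card {w \<in> lang n \<tau>. length w = 2} = N"
  shows "\<exists>\<tau>'. is_subst N \<tau>' \<and> suffix_perm N \<tau>'
     \<and> (\<exists>p'. bij_betw p' {..<n} (fixpts N \<tau>') \<and> (\<forall>i<n. branch_point (Xsub N \<tau>') (p' i) (k i)))
     \<and> top_conj (Xsub n \<tau>) (Xsub N \<tau>')
     \<and> (\<exists>V. continuous_on (bratteli_paths N \<tau>') V \<and> V ` bratteli_paths N \<tau>' \<subseteq> bratteli_paths N \<tau>'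
          \<and> (\<forall>p\<in>bratteli_paths N \<tau>'. \<not> max_path \<tau>' p \<longrightarrow> V p = vershik \<tau>' p)
          \<and> (\<exists>h g. homeomorphism (Xsub N \<tau>') (bratteli_paths N \<tau>') h g
                 \<and> (\<forall>x\<in>Xsub N \<tau>'. h (shift x) = V (h x))))"
proof -
  obtain p where p: "bij_betw p {..<n} (fixpts n \<tau>)" and br: "\<And>i. i < n \<Longrightarrow> branch_point (Xsub n \<tau>) (p i) (k i)"
    using assms(4) by blast
  have subst: "is_subst n \<tau>" and recog: "unilat_recognizable n \<tau>" using assms(1) by (auto simp: standing_def)
  have ne: "\<tau> a \<noteq> []" if "a < n" for a using assms(2) that by (simp add: prefix_perm_def)
  have fp: "x 0 < n" "hd (\<tau> (x 0)) = x 0" "2 \<le> length (\<tau> (x 0))" if "x \<in> fixpts n \<tau>" for x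
  proof -
    show less: "x 0 < n" using that by (simp add: fixpts_def)
    show hd: "hd (\<tau> (x 0)) = x 0" by (rule fixpts_hd[OF ne that])
    show "2 \<le> length (\<tau> (x 0))"
      using standing_image_ne_singleton[OF assms(1) less] hd ne[OF less]
      by (cases "\<tau> (x 0)"; cases "tl (\<tau> (x 0))") auto
  qed
  \<comment> \<open>A fixed point is determined by its first letter, so the first letters of the
    \<open>n\<close> fixed points are \<open>n\<close> distinct elements of an
    \<open>n\<close>-letter alphabet. Every letter therefore starts a fixed point and is the head of
    its own image.\<close>
  have "inj_on (\<lambda>x. x 0) (fixpts n \<tau>)"
  proof (rule inj_onI)
    fix x y assume "x \<in> fixpts n \<tau>" "y \<in> fixpts n \<tau>" "x 0 = y 0"
    then show "x = y" using fixpts_eqI[of n \<tau> x y] ne fp(3) by blast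
  qed
  then have "card ((\<lambda>x. x 0) ` fixpts n \<tau>) = n"
    using bij_betw_same_card[OF p] by (simp add: card_image)
  then have img: "(\<lambda>x. x 0) ` fixpts n \<tau> = {..<n}"
    using fp(1) by (intro card_subset_eq) auto
  obtain e where e: "bij_betw e {w \<in> lang n \<tau>. length w = 2} {0..<card {w \<in> lang n \<tau>. length w = 2}}"
    using ex_bij_betw_finite_nat[OF finite_lang_length[OF subst]] by blast
  interpret two_block n N \<tau> e
  proof
    show ex: "\<exists>u\<in>fixpts n \<tau>. u 0 = a" if "a < n" for a using img that by (metis (mono_tags, lifting) imageE lessThan_iff)
    show "hd (\<tau> a) = a" "2 \<le> length (\<tau> a)" if "a < n" for a using ex[OF that] fp by auto
    show "inj_on (\<lambda>a. last (\<tau> a)) {..<n}" using assms(3) by (simp add: suffix_perm_def bij_betw_def)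
    show "bij_betw e {w \<in> lang n \<tau>. length w = 2} {..<N}" using e assms(5) by (simp add: atLeast0LessThan)
  qed (fact subst recog)+
  have "bij_betw (code \<circ> p) {..<n} (fixpts N tau2)"
    using fixpts_Y unfolding fixpts_tau2
    by (intro bij_betw_trans[OF p] inj_on_imp_bij_betw inj_on_subset[OF code_inj]) auto
  moreover have "\<forall>i<n. branch_point (Xsub N tau2) ((code \<circ> p) i) (k i)"
    using br branch_point_code by simp
  moreover have "top_conj (Xsub n \<tau>) (Xsub N tau2)"
    unfolding top_conj_def using code_homeomorphism code_shift by blast
  ultimately show ?thesis
    using is_subst_tau2 suffix_perm_tau2 vershik_conjugacy by blast
qed

end
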